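(* Let $\varphi$ be the Laplace transform of a probability distribution on $[0,\infty)$. A characteristic function $f$ on $\mathbf{R}$ has a non-empty domain of partial $\varphi$-attraction if and only if $f$ is $\varphi$-ID.
   Context: $\varphi(s)=E(e^{-sU})$ for a non-negative random variable $U$, used for all complex $s$ with $\operatorname{Re}s\ge 0$. A characteristic function $g$ belongs to the domain of partial $\varphi$-attraction of a characteristic function $f$ if there are a subsequence $n_k\to\infty$ of the positive integers and constants $a_k>0$ and $b_k\in\mathbf{R}$ such that, with $g_k(t)=g(t/a_k)\exp(-itb_k)$, $\varphi\{n_k(1-g_k(t))\}\to f(t)$ as $k\to\infty$ for all $t\in\mathbf{R}$. (Here $\varphi\{n_k(1-s)\}$ is the probability generating function of the number of summands, taken independent of the summands.) A characteristic function $f$ is called $\varphi$-ID if there are positive constants $a_n$ and characteristic functions $f_n$ ($n\ge1$) such that $f(t)=\lim_{n\to\infty}\varphi\{a_n(1-f_n(t))\}$ for all $t\in\mathbf{R}$. *)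

theory Defs
  imports "HOL-Probability.Probability"
begin

definition is_char_fun :: "(real \<Rightarrow> complex) \<Rightarrow> bool" where
  "is_char_fun f \<longleftrightarrow> (\<exists>M. real_distribution M \<and> f = char M)"

definition nonneg_distribution :: "real measure \<Rightarrow> bool" where
  "nonneg_distribution \<mu> \<longleftrightarrow> real_distribution \<mu> \<and> (AE u in \<mu>. 0 \<le> u)"

(* For a distribution on the half-line the integrand is bounded when Re s >= 0. For Re s < 0 it
   need not be integrable; no notion below evaluates the transform there, since a characteristic
   function g satisfies Re (1 - g t) >= 0. *)
definition laplace_transform :: "real measure \<Rightarrow> complex \<Rightarrow> complex" where
  "laplace_transform \<mu> s = (CLINT u|\<mu>. exp (- s * complex_of_real u))"

definition partial_attraction_domain ::
    "(complex \<Rightarrow> complex) \<Rightarrow> (real \<Rightarrow> complex) \<Rightarrow> (real \<Rightarrow> complex) set" where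
  "partial_attraction_domain \<phi> f =
    {g. is_char_fun g \<and>
        (\<exists>(n :: nat \<Rightarrow> nat) (a :: nat \<Rightarrow> real) (b :: nat \<Rightarrow> real).
           strict_mono n \<and> (\<forall>k. 0 < n k) \<and> (\<forall>k. 0 < a k) \<and>
           (\<forall>t. (\<lambda>k. \<phi> (of_nat (n k) *
                     (1 - g (t / a k) * exp (- (\<i> * complex_of_real (t * b k))))))
                 \<longlonglongrightarrow> f t))}"

definition phi_ID :: "(complex \<Rightarrow> complex) \<Rightarrow> (real \<Rightarrow> complex) \<Rightarrow> bool" where
  "phi_ID \<phi> f \<longleftrightarrow> is_char_fun f \<and>
    (\<exists>(a :: nat \<Rightarrow> real) (F :: nat \<Rightarrow> real \<Rightarrow> complex).
       (\<forall>n\<ge>1. 0 < a n \<and> is_char_fun (F n)) \<and>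
       (\<forall>t. (\<lambda>n. \<phi> (complex_of_real (a n) * (1 - F n t))) \<longlonglongrightarrow> f t))"

end

theory Submission
  imports Defs
begin

text \<open>
  If \<open>f\<close> is the limit of \<open>\<phi> (a\<^sub>k (1 - f\<^sub>k))\<close>, an element of its domain of partial attraction is
  obtained by a Doeblin-type construction: with integers \<open>n\<^sub>k\<close> and scales \<open>c\<^sub>k\<close> that grow fast enough,
  put \<open>1 - g(t) = \<Sum>\<^sub>j (a\<^sub>j / n\<^sub>j) (1 - f\<^sub>j(c\<^sub>j t))\<close>, so that \<open>g\<close> is a mixture of characteristic functions.
  In \<open>n\<^sub>k (1 - g(t / c\<^sub>k))\<close> the term \<open>j = k\<close> equals \<open>a\<^sub>k (1 - f\<^sub>k(t))\<close>, the terms \<open>j > k\<close> are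
  small because \<open>n\<^sub>j\<close> is large compared with \<open>n\<^sub>k\<close>, and the terms \<open>j < k\<close> are small because \<open>f\<^sub>j\<close> is
  continuous at \<open>0\<close> and \<open>c\<^sub>j / c\<^sub>k\<close> is small. As \<open>\<phi>\<close> is uniformly continuous on \<open>Re s \<ge> 0\<close>, the errors
  do not affect the limit; no centring constants are needed.
\<close>

section \<open>Characteristic functions and their closure operations\<close>

lemma is_char_fun_zero: "is_char_fun f \<Longrightarrow> f 0 = 1"
  unfolding is_char_fun_def using real_distribution.char_zero by auto

lemma is_char_fun_norm_le_1: "is_char_fun f \<Longrightarrow> norm (f t) \<le> 1"
  unfolding is_char_fun_def using real_distribution.cmod_char_le_1 by auto

lemma is_char_fun_isCont: "is_char_fun f \<Longrightarrow> isCont f t"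
  unfolding is_char_fun_def using real_distribution.isCont_char by auto

lemma is_char_fun_Re_one_minus: "is_char_fun f \<Longrightarrow> 0 \<le> Re (1 - f t)"
  using is_char_fun_norm_le_1[of f t] complex_Re_le_cmod[of "f t"] by simp

lemma is_char_fun_norm_one_minus: "is_char_fun f \<Longrightarrow> norm (1 - f t) \<le> 2"
  using is_char_fun_norm_le_1[of f t] norm_triangle_ineq4[of 1 "f t"] by simp

lemma is_char_fun_const_1: "is_char_fun (\<lambda>_. 1)"
  unfolding is_char_fun_def
proof (intro exI conjI)
  show "real_distribution (return borel 0)"
    by (intro real_distribution.intro real_distribution_axioms.intro prob_space_return) auto
  show "(\<lambda>_. 1) = char (return borel 0)"
    by (simp add: fun_eq_iff char_def integral_return)
qed

text \<open>If \<open>f\<close> belongs to a random variable \<open>X\<close>, this is the transform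
  of \<open>c * X - b\<close>. With \<open>c = 1 / a k\<close> it covers the norming and centring in
  the domain of partial attraction.\<close>

lemma is_char_fun_affine:
  assumes "is_char_fun f"
  shows "is_char_fun (\<lambda>t. f (c * t) * exp (- (\<i> * complex_of_real (t * b))))"
proof -
  obtain M where M: "real_distribution M" and f: "f = char M"
    using assms unfolding is_char_fun_def by auto
  interpret M: real_distribution M by fact
  let ?D = "distr M borel (\<lambda>x. c * x - b)"
  have "char ?D t = f (c * t) * exp (- (\<i> * complex_of_real (t * b)))" for t
  proof -
    have "char ?D t = (CLINT x|M. exp (\<i> * complex_of_real (t * (c * x - b))))"
      unfolding char_def by (subst integral_distr) auto
    also have "\<dots> = (CLINT x|M. exp (\<i> * complex_of_real (c * t * x)) *
        exp (- (\<i> * complex_of_real (t * b))))"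
      by (intro Bochner_Integration.integral_cong refl)
        (simp add: exp_add[symmetric] algebra_simps)
    finally show ?thesis
      unfolding f char_def by simp
  qed
  moreover have "real_distribution ?D"
    by (intro real_distribution.intro real_distribution_axioms.intro M.prob_space_distr) auto
  ultimately show ?thesis
    unfolding is_char_fun_def by (intro exI[of _ ?D]) auto
qed

lemma is_char_fun_scale: "is_char_fun f \<Longrightarrow> is_char_fun (\<lambda>t. f (c * t))"
  using is_char_fun_affine[of f c 0] by simp

text \<open>Drawing \<open>j\<close> from \<open>p\<close> and then a point from \<open>M j\<close>
  gives the law \<open>measure_pmf p \<bind> M\<close>, whose transform is the mixture.\<close>

lemma is_char_fun_mixture:
  fixes p :: "'a pmf"
  assumes "\<And>j. is_char_fun (F j)"
  shows "is_char_fun (\<lambda>t. measure_pmf.expectation p (\<lambda>j. F j t))"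
proof -
  obtain M where M: "\<And>j. real_distribution (M j)" and F: "\<And>j. F j = char (M j)"
    using assms unfolding is_char_fun_def by metis
  interpret M: real_distribution "M j" for j by (rule M)
  have kernel: "M \<in> measurable (measure_pmf p) (subprob_algebra borel)"
    by (auto simp: measurable_def space_subprob_algebra
        intro: prob_space_imp_subprob_space M.prob_space_axioms)
  let ?B = "measure_pmf p \<bind> M"
  interpret B: real_distribution ?B
    by (intro real_distribution.intro real_distribution_axioms.intro
        measure_pmf.prob_space_bind[OF _ kernel] sets_bind[where N=borel])
       (auto intro: M.prob_space_axioms)
  \<comment> \<open>Stated for bounded real integrands, to be applied to the real and the imaginary
    part of \<open>iexp\<close> separately.\<close>
  have bind: "integral\<^sup>L ?B h = (\<integral>j. integral\<^sup>L (M j) h \<partial>p)"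
    if "h \<in> borel_measurable borel" "\<And>x. \<bar>h x\<bar> \<le> 1" for h :: "real \<Rightarrow> real"
  proof (rule integral_bind[where K=borel and B=1 and B'=1])
    show "AE j in p. emeasure (M j) (space (M j)) \<le> ennreal 1"
      by (simp add: M.emeasure_space_1 del: M.space_eq_univ)
  qed (use that kernel measure_pmf.finite_measure_axioms in auto)
  have "char ?B t = measure_pmf.expectation p (\<lambda>j. F j t)" for t
  proof -
    have int: "integrable p (\<lambda>j. F j t)"
      by (intro measure_pmf.integrable_const_bound[where B=1])
         (auto simp: F M.cmod_char_le_1)
    have iexp: "integrable N (\<lambda>x. iexp (t * x))" if "real_distribution N" for N
    proof -
      interpret N: real_distribution N by fact
      show ?thesis by (intro N.integrable_iexp) auto
    qed
    have bound: "\<bar>Re (iexp x)\<bar> \<le> 1" "\<bar>Im (iexp x)\<bar> \<le> 1" for x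
      using abs_Re_le_cmod[of "iexp x"] abs_Im_le_cmod[of "iexp x"] by (simp_all del: Re_exp Im_exp)
    have "Re (char ?B t) = Re (measure_pmf.expectation p (\<lambda>j. F j t))"
      using bind[of "\<lambda>x. Re (iexp (t * x))", OF _ bound(1)] int
        iexp[OF M] iexp[OF B.real_distribution_axioms]
      by (simp add: F char_def flip: integral_Re)
    moreover have "Im (char ?B t) = Im (measure_pmf.expectation p (\<lambda>j. F j t))"
      using bind[of "\<lambda>x. Im (iexp (t * x))", OF _ bound(2)] int
        iexp[OF M] iexp[OF B.real_distribution_axioms]
      by (simp add: F char_def flip: integral_Im)
    ultimately show ?thesis
      by (rule complex_eqI)
  qed
  then show ?thesis
    unfolding is_char_fun_def
    using B.real_distribution_axioms by (intro exI[of _ ?B]) auto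
qed

text \<open>Mix \<open>f\<close> with weight \<open>v\<close> and the point mass at 0 with weight
  \<open>1 - v\<close>.\<close>

lemma is_char_fun_thinning:
  assumes "is_char_fun f" "0 \<le> v" "v \<le> 1"
  shows "is_char_fun (\<lambda>t. 1 - complex_of_real v * (1 - f t))"
proof -
  have "is_char_fun (\<lambda>t. measure_pmf.expectation (bernoulli_pmf v)
      (\<lambda>j. (if j then f else (\<lambda>_. 1)) t))"
    by (rule is_char_fun_mixture) (use assms is_char_fun_const_1 in auto)
  also have "(\<lambda>t. measure_pmf.expectation (bernoulli_pmf v) (\<lambda>j. (if j then f else (\<lambda>_. 1)) t))
      = (\<lambda>t. 1 - complex_of_real v * (1 - f t))"
    using assms by (subst integral_measure_pmf[of UNIV])
      (auto simp: UNIV_bool fun_eq_iff scaleR_conv_of_real algebra_simps)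
  finally show ?thesis .
qed

section \<open>Uniform continuity of the Laplace transform on the closed right half-plane\<close>

text \<open>Mean value inequality on a convex set: the derivative in \<open>s\<close> has norm at
  most \<open>u\<close> there.\<close>

lemma norm_exp_diff_le_right_half_plane:
  fixes z w :: complex
  assumes "0 \<le> Re z" "0 \<le> Re w" "0 \<le> u"
  shows "norm (exp (- z * complex_of_real u) - exp (- w * complex_of_real u)) \<le> u * norm (z - w)"
proof (rule field_differentiable_bound[where S = "{s. Re s \<ge> 0}"
      and f' = "\<lambda>s. - complex_of_real u * exp (- s * complex_of_real u)"])
  show "convex {s. Re s \<ge> 0}"
    by (rule convex_halfspace_Re_ge)
  show "((\<lambda>s. exp (- s * complex_of_real u)) has_field_derivative
      - complex_of_real u * exp (- s * complex_of_real u)) (at s within {s. Re s \<ge> 0})" for s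
    by (auto intro!: derivative_eq_intros)
  show "norm (- complex_of_real u * exp (- s * complex_of_real u)) \<le> u"
    if "s \<in> {s. Re s \<ge> 0}" for s
    using that assms by (auto simp: norm_mult norm_exp_eq_Re intro: mult_left_le)
qed (use assms in auto)

text \<open>Uniform continuity in sequential form. Since \<open>\<mu>\<close> may have infinite
  mean, the Lipschitz bound \<open>u * norm (z - w)\<close> is used only pointwise in
  \<open>u\<close>; dominated convergence with the constant 2 does the rest.\<close>

lemma laplace_transform_uniformly_continuous:
  assumes \<mu>: "nonneg_distribution \<mu>"
    and Re: "\<And>k. 0 \<le> Re (z k)" "\<And>k. 0 \<le> Re (w k)"
    and diff: "(\<lambda>k. z k - w k) \<longlonglongrightarrow> 0"
  shows "(\<lambda>k. laplace_transform \<mu> (z k) - laplace_transform \<mu> (w k)) \<longlonglongrightarrow> 0"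
proof -
  interpret real_distribution \<mu>
    using \<mu> unfolding nonneg_distribution_def by simp
  have nonneg: "AE u in \<mu>. 0 \<le> u"
    using \<mu> unfolding nonneg_distribution_def by simp
  have norm_le: "norm (exp (- s * complex_of_real u)) \<le> 1" if "0 \<le> Re s" "0 \<le> u" for s u
    using that by (simp add: norm_exp_eq_Re)
  have int: "integrable \<mu> (\<lambda>u. exp (- s * complex_of_real u))" if "0 \<le> Re s" for s
  proof (rule integrable_const_bound[where B=1])
    show "AE u in \<mu>. norm (exp (- s * complex_of_real u)) \<le> 1"
      using nonneg by eventually_elim (rule norm_le[OF that])
  qed simp
  have "(\<lambda>k. CLINT u|\<mu>. exp (- z k * complex_of_real u) - exp (- w k * complex_of_real u))
      \<longlonglongrightarrow> (CLINT u|\<mu>. 0)"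
  proof (rule integral_dominated_convergence[where w = "\<lambda>_. 2"])
    show "AE u in \<mu>. (\<lambda>k. exp (- z k * complex_of_real u) - exp (- w k * complex_of_real u))
        \<longlonglongrightarrow> 0"
      using nonneg
    proof eventually_elim
      case (elim u)
      have "(\<lambda>k. u * norm (z k - w k)) \<longlonglongrightarrow> 0"
        using tendsto_mult[OF tendsto_const[of u] tendsto_norm[OF diff]] by simp
      then show ?case
        by (rule Lim_null_comparison[rotated])
           (use elim Re norm_exp_diff_le_right_half_plane in auto)
    qed
    show "AE u in \<mu>. norm (exp (- z k * complex_of_real u) - exp (- w k * complex_of_real u)) \<le> 2"
      for k
      using nonneg
    proof eventually_elim
      case (elim u)
      show ?case
        using norm_triangle_ineq4[of "exp (- z k * complex_of_real u)"
            "exp (- w k * complex_of_real u)"]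
          norm_le[OF Re(1)[of k] elim] norm_le[OF Re(2)[of k] elim] by linarith
    qed
  qed auto
  then show ?thesis
    unfolding laplace_transform_def using int Re by (simp del: mult_minus_left)
qed

section \<open>Rapidly growing sequences\<close>

text \<open>The recursion controls consecutive terms only. For \<open>m j > 0\<close> monotonicity
  of \<open>n\<close> extends the bound to all \<open>k < j\<close>; for \<open>m j \<le> 0\<close>
  the bound is trivial.\<close>

lemma exists_rapidly_growing_nat:
  fixes m :: "nat \<Rightarrow> real"
  shows "\<exists>n :: nat \<Rightarrow> nat. strict_mono n \<and> (\<forall>k. 0 < n k) \<and> (\<forall>k. m k \<le> real (n k)) \<and>
    (\<forall>j k. k < j \<longrightarrow> m j * real (n k) \<le> real (n j))"
proof -
  have "\<exists>n :: nat \<Rightarrow> nat. \<forall>k. (0 < n k \<and> m k \<le> real (n k)) \<and>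
      (n k < n (Suc k) \<and> m (Suc k) * real (n k) \<le> real (n (Suc k)))"
  proof (rule dependent_nat_choice)
    show "\<exists>x::nat. 0 < x \<and> m 0 \<le> real x"
      using real_nat_ceiling_ge[of "m 0"]
      by (intro exI[of _ "Suc (nat \<lceil>m 0\<rceil>)"]) auto
    fix x k :: nat
    \<comment> \<open>\<open>r\<close> collects the three lower bounds; the successor of its ceiling
      makes \<open>x < y\<close> strict.\<close>
    define r where "r = max (max (m (Suc k)) (m (Suc k) * x)) x"
    have "r \<le> Suc (nat \<lceil>r\<rceil>)" "x < Suc (nat \<lceil>r\<rceil>)"
      using real_nat_ceiling_ge[of r] unfolding r_def by linarith+
    then show "\<exists>y::nat. (0 < y \<and> m (Suc k) \<le> real y) \<and> (x < y \<and> m (Suc k) * real x \<le> real y)"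
      by (intro exI[of _ "Suc (nat \<lceil>r\<rceil>)"]) (auto simp: r_def)
  qed
  then obtain n :: "nat \<Rightarrow> nat" where
    n: "\<And>k. 0 < n k" "\<And>k. m k \<le> real (n k)" "\<And>k. n k < n (Suc k)"
       "\<And>k. m (Suc k) * real (n k) \<le> real (n (Suc k))"
    by blast
  have mono: "strict_mono n"
    using n(3) by (simp add: strict_mono_Suc_iff)
  have "m j * real (n k) \<le> real (n j)" if kj: "k < j" for j k
  proof (cases "m j \<le> 0")
    case True
    then show ?thesis
      by (meson mult_nonpos_nonneg of_nat_0_le_iff order_trans)
  next
    case False
    obtain i where j: "j = Suc i" using kj by (cases j) auto
    have "n k \<le> n i"
      using mono kj j by (simp add: strict_mono_less_eq)
    then have "m j * n k \<le> m j * n i"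
      using False by (intro mult_left_mono) auto
    also have "\<dots> \<le> n j"
      using n(4)[of i] j by simp
    finally show ?thesis .
  qed
  then show ?thesis
    using mono n by blast
qed

lemma exists_rapidly_growing_real:
  fixes m :: "nat \<Rightarrow> real"
  shows "\<exists>c :: nat \<Rightarrow> real. (\<forall>k. 0 < c k) \<and> (\<forall>j k. j < k \<longrightarrow> m k * c j \<le> c k)"
proof -
  obtain n :: "nat \<Rightarrow> nat" where "\<forall>k. 0 < n k" "\<forall>j k. k < j \<longrightarrow> m j * real (n k) \<le> real (n j)"
    using exists_rapidly_growing_nat[of m] by blast
  then show ?thesis
    by (intro exI[of _ "\<lambda>k. real (n k)"]) auto
qed

section \<open>The Doeblin-type construction\<close>

text \<open>Continuity at 0, where the value is 1, gives one neighbourhood for each of the finitely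
  many \<open>j < k\<close>; these are intersected.\<close>

lemma char_funs_uniformly_near_1:
  fixes F :: "nat \<Rightarrow> real \<Rightarrow> complex"
  assumes "\<And>j. is_char_fun (F j)" "0 < e"
  shows "\<exists>r>0. \<forall>j<k. \<forall>u. \<bar>u\<bar> \<le> r \<longrightarrow> norm (1 - F j u) \<le> e"
proof -
  have "eventually (\<lambda>u. norm (1 - F j u) < e) (nhds 0)" for j
  proof -
    have "((\<lambda>u. norm (1 - F j u)) \<longlongrightarrow> norm (1 - F j 0)) (nhds 0)"
      using is_char_fun_isCont[OF assms(1)[of j], of 0]
      by (intro tendsto_intros) (simp add: isCont_def tendsto_at_iff_tendsto_nhds)
    then show ?thesis
      using assms is_char_fun_zero[OF assms(1)[of j]] by (intro order_tendstoD) auto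
  qed
  then have "eventually (\<lambda>u. \<forall>j\<in>{..<k}. norm (1 - F j u) < e) (nhds 0)"
    by (intro eventually_ball_finite) auto
  then obtain d where "0 < d" "\<And>u. dist u 0 < d \<Longrightarrow> \<forall>j\<in>{..<k}. norm (1 - F j u) < e"
    unfolding eventually_nhds_metric by auto
  then show ?thesis
    by (intro exI[of _ "d / 2"]) (auto simp: dist_norm less_imp_le)
qed

text \<open>The coefficients \<open>a j / n j\<close> need not sum to 1. Hence \<open>g\<close>
  mixes with a fixed law \<open>p\<close>, and each component is thinned by a factor
  \<open>v j\<close> that corrects its weight.\<close>

lemma universal_char_fun:
  fixes a :: "nat \<Rightarrow> real" and F :: "nat \<Rightarrow> real \<Rightarrow> complex"
  assumes a: "\<And>k. 0 < a k" and F: "\<And>k. is_char_fun (F k)"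
  shows "\<exists>g (n :: nat \<Rightarrow> nat) c. is_char_fun g \<and> strict_mono n \<and> (\<forall>k. 0 < n k) \<and> (\<forall>k. 0 < c k) \<and>
    (\<forall>t. (\<lambda>k. of_nat (n k) * (1 - g (t / c k)) - complex_of_real (a k) * (1 - F k t)) \<longlonglongrightarrow> 0)"
proof -
  \<comment> \<open>Any law charging every natural number would serve.\<close>
  define p where "p = geometric_pmf (1 / 2)"
  have p: "0 < pmf p j" for j
    by (simp add: p_def)
  \<comment> \<open>The multiplier is chosen so that \<open>n_ge\<close> yields
    \<open>v k \<le> 1\<close> and \<open>n_growth\<close> makes \<open>n k * v j\<close> small for
    \<open>j > k\<close>.\<close>
  obtain n :: "nat \<Rightarrow> nat" where n: "strict_mono n" "\<And>k. 0 < n k"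
    and n_ge: "\<And>k. a k / pmf p k * real (Suc k) \<le> real (n k)"
    and n_growth: "\<And>j k. k < j \<Longrightarrow> a j / pmf p j * real (Suc j) * real (n k) \<le> real (n j)"
    using exists_rapidly_growing_nat[of "\<lambda>k. a k / pmf p k * real (Suc k)"] by blast
  \<comment> \<open>The tolerance absorbs the factor \<open>n k\<close> and leaves
    \<open>1 / (k + 1)\<close>.\<close>
  have "\<forall>k. \<exists>r>0. \<forall>j<k. \<forall>u. \<bar>u\<bar> \<le> r \<longrightarrow> norm (1 - F j u) \<le> 1 / (real (n k) * real (Suc k))"
    using n(2) by (intro allI char_funs_uniformly_near_1[OF F]) auto
  then obtain r where r: "\<And>k. 0 < r k"
    and r_near: "\<And>k j u. j < k \<Longrightarrow> \<bar>u\<bar> \<le> r k \<Longrightarrow> norm (1 - F j u) \<le> 1 / (real (n k) * real (Suc k))"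
    by metis
  \<comment> \<open>This growth brings the argument \<open>c j * t / c k\<close> within
    \<open>r k\<close> for all \<open>\<bar>t\<bar> \<le> k\<close> and
    \<open>j < k\<close>.\<close>
  obtain c where c: "\<And>k. 0 < c k" and c_growth: "\<And>j k. j < k \<Longrightarrow> real k / r k * c j \<le> c k"
    using exists_rapidly_growing_real[of "\<lambda>k. real k / r k"] by blast
  \<comment> \<open>Chosen so that \<open>pmf p j * v j = a j / n j\<close>.\<close>
  define v where "v = (\<lambda>j. a j / (real (n j) * pmf p j))"
  define g where "g = (\<lambda>t. measure_pmf.expectation p
      (\<lambda>j. 1 - complex_of_real (v j) * (1 - F j (c j * t))))"
  have v0: "0 < v j" for j
    using a n p by (simp add: v_def)
  have v1: "v j \<le> 1" for j
  proof -
    have "a j / pmf p j * 1 \<le> a j / pmf p j * real (Suc j)"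
      using a[of j] p[of j] by (intro mult_left_mono) auto
    then have "a j / pmf p j \<le> real (n j)"
      using n_ge[of j] by simp
    then show ?thesis
      using n(2)[of j] p[of j] by (simp add: v_def field_simps)
  qed
  have v_small: "real (n k) * v j \<le> 1 / real (Suc k)" if "k < j" for j k
  proof -
    have "real (n k) * v j \<le> 1 / real (Suc j)"
      using n_growth[OF that] n(2)[of j] p[of j] by (simp add: v_def field_simps)
    also have "\<dots> \<le> 1 / real (Suc k)"
      using that by (intro divide_left_mono) auto
    finally show ?thesis .
  qed
  have mix: "is_char_fun (\<lambda>t. 1 - complex_of_real (v j) * (1 - F j (c j * t)))" for j
    using is_char_fun_thinning[OF is_char_fun_scale[OF F]] v0[of j] v1[of j] by (simp add: less_imp_le)
  have error: "norm (of_nat (n k) * (1 - g (t / c k)) - complex_of_real (a k) * (1 - F k t))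
      \<le> 2 / real (Suc k)" if t: "\<bar>t\<bar> \<le> real k" for t k
  proof -
    let ?X = "\<lambda>j. 1 - F j (c j * (t / c k))"
    \<comment> \<open>The integrand without its diagonal term; that term has expectation
      \<open>pmf p k * n k * v k * (1 - F k t) = a k * (1 - F k t)\<close>.\<close>
    let ?D = "\<lambda>j. if j = k then 0 else complex_of_real (real (n k) * v j) * ?X j"
    have X: "norm (?X j) \<le> 2" for j
      by (rule is_char_fun_norm_one_minus[OF F])
    have int: "integrable p (\<lambda>j. complex_of_real (v j) * ?X j)"
    proof (rule measure_pmf.integrable_const_bound[where B = 2])
      show "AE j in p. norm (complex_of_real (v j) * ?X j) \<le> 2"
      proof (rule AE_pmfI)
        fix j
        show "norm (complex_of_real (v j) * ?X j) \<le> 2"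
          using mult_mono[OF v1[of j] X[of j]] v0[of j] by (simp add: norm_mult)
      qed
    qed simp
    have "1 - g (t / c k) = measure_pmf.expectation p (\<lambda>j. complex_of_real (v j) * ?X j)"
      using int unfolding g_def by simp
    then have "of_nat (n k) * (1 - g (t / c k)) =
        measure_pmf.expectation p (\<lambda>j. complex_of_real (real (n k) * v j) * ?X j)"
      by (simp add: mult.assoc)
    also have "\<dots> = measure_pmf.expectation p
        (\<lambda>j. ?D j + (if j = k then complex_of_real (real (n k) * v k) * (1 - F k t) else 0))"
      using c[of k] by (intro Bochner_Integration.integral_cong) auto
    also have "\<dots> = measure_pmf.expectation p ?D + measure_pmf.expectation p
        (\<lambda>j. if j = k then complex_of_real (real (n k) * v k) * (1 - F k t) else 0)"
    proof (rule Bochner_Integration.integral_add)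
      have "integrable p (\<lambda>j. indicator (- {k}) j *\<^sub>R
          (complex_of_real (n k) * (complex_of_real (v j) * ?X j)))"
        by (intro integrable_mult_indicator integrable_mult_right int) auto
      also have "(\<lambda>j. indicator (- {k}) j *\<^sub>R
          (complex_of_real (n k) * (complex_of_real (v j) * ?X j))) = ?D"
        by (auto simp: fun_eq_iff)
      finally show "integrable p ?D" .
      show "integrable p (\<lambda>j. if j = k then complex_of_real (real (n k) * v k) * (1 - F k t) else 0)"
        by (rule measure_pmf.integrable_const_bound
            [where B = "norm (complex_of_real (real (n k) * v k) * (1 - F k t))"]) auto
    qed
    also have "measure_pmf.expectation p
        (\<lambda>j. if j = k then complex_of_real (real (n k) * v k) * (1 - F k t) else 0) =
        complex_of_real (a k) * (1 - F k t)"
      using n(2)[of k] p[of k]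
      by (subst integral_measure_pmf[of "{k}"]) (auto simp: v_def scaleR_conv_of_real split: if_splits)
    finally have "of_nat (n k) * (1 - g (t / c k)) - complex_of_real (a k) * (1 - F k t) =
        measure_pmf.expectation p ?D"
      by simp
    \<comment> \<open>For \<open>j < k\<close> the factor \<open>?X j\<close> is small by choice of
      \<open>c\<close>; for \<open>j > k\<close> the coefficient is small by choice of
      \<open>n\<close>. A bound uniform in \<open>j\<close> passes to the expectation.\<close>
    moreover have "norm (?D j) \<le> 2 / real (Suc k)" for j
    proof (cases j k rule: linorder_cases)
      case less
      have "\<bar>c j * (t / c k)\<bar> = \<bar>t\<bar> * c j / c k"
        using c[of j] c[of k] by (simp add: abs_mult)
      also have "\<dots> \<le> real k * c j / c k"
        using t c[of j] c[of k] by (intro divide_right_mono mult_right_mono) auto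
      also have "\<dots> \<le> r k"
        using c_growth[OF less] c[of k] r[of k] by (simp add: field_simps)
      finally have "norm (?X j) \<le> 1 / (real (n k) * real (Suc k))"
        by (rule r_near[OF less])
      then have "v j * norm (?X j) \<le> 1 * (1 / (real (n k) * real (Suc k)))"
        using v0[of j] v1[of j] by (intro mult_mono) auto
      then have "real (n k) * (v j * norm (?X j)) \<le> real (n k) * (1 * (1 / (real (n k) * real (Suc k))))"
        by (intro mult_left_mono) auto
      also have "\<dots> = 1 / real (Suc k)"
        using n(2)[of k] by simp
      also have "\<dots> \<le> 2 / real (Suc k)"
        by (intro divide_right_mono) auto
      finally show ?thesis
        using less v0[of j] by (simp add: norm_mult mult.assoc)
    next
      case greater
      have "real (n k) * v j * norm (?X j) \<le> 1 / real (Suc k) * 2"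
        using v_small[OF greater] X[of j] v0[of j] by (intro mult_mono) auto
      then show ?thesis
        using greater v0[of j] by (simp add: norm_mult)
    qed simp
    then have "measure_pmf.expectation p (\<lambda>j. norm (?D j)) \<le> 2 / real (Suc k)"
      by (intro measure_pmf.integral_le_const
          measure_pmf.integrable_const_bound[where B = "2 / real (Suc k)"]) auto
    then have "norm (measure_pmf.expectation p ?D) \<le> 2 / real (Suc k)"
      by (rule order_trans[OF integral_norm_bound])
    ultimately show ?thesis by simp
  qed
  have "(\<lambda>k. of_nat (n k) * (1 - g (t / c k)) - complex_of_real (a k) * (1 - F k t)) \<longlonglongrightarrow> 0" for t
  proof (rule Lim_null_comparison)
    show "(\<lambda>k. 2 / real (Suc k)) \<longlonglongrightarrow> 0"
      using tendsto_mult[OF tendsto_const[of 2] LIMSEQ_inverse_real_of_nat]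
      by (simp add: divide_inverse)
    show "\<forall>\<^sub>F k in sequentially.
        norm (of_nat (n k) * (1 - g (t / c k)) - complex_of_real (a k) * (1 - F k t)) \<le> 2 / real (Suc k)"
      using eventually_ge_at_top[of "nat \<lceil>\<bar>t\<bar>\<rceil>"]
      by eventually_elim (intro error, linarith)
  qed
  moreover have "is_char_fun g"
    unfolding g_def by (rule is_char_fun_mixture) (rule mix)
  ultimately show ?thesis
    using n c by blast
qed

section \<open>Partial attraction and \<open>phi_ID\<close>\<close>

theorem theorem4p2:
  fixes \<mu> :: "real measure" and \<phi> :: "complex \<Rightarrow> complex" and f :: "real \<Rightarrow> complex"
  assumes "nonneg_distribution \<mu>"
    and "\<And>s. 0 \<le> Re s \<Longrightarrow> \<phi> s = laplace_transform \<mu> s"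
    and "is_char_fun f"
  shows "partial_attraction_domain \<phi> f \<noteq> {} \<longleftrightarrow> phi_ID \<phi> f"
proof
  assume "partial_attraction_domain \<phi> f \<noteq> {}"
  then obtain g and n :: "nat \<Rightarrow> nat" and a b :: "nat \<Rightarrow> real" where
    g: "is_char_fun g" and n: "\<And>k. 0 < n k" and
    lim: "\<And>t. (\<lambda>k. \<phi> (of_nat (n k) *
      (1 - g (t / a k) * exp (- (\<i> * complex_of_real (t * b k)))))) \<longlonglongrightarrow> f t"
    unfolding partial_attraction_domain_def by blast
  \<comment> \<open>The normed and centred \<open>g\<close> can itself serve as \<open>F k\<close>,
    with \<open>n k\<close> as the positive constant.\<close>
  have "is_char_fun (\<lambda>t. g (t / a k) * exp (- (\<i> * complex_of_real (t * b k))))" for k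
    using is_char_fun_affine[OF g, of "1 / a k" "b k"] by simp
  with n lim assms(3) show "phi_ID \<phi> f"
    unfolding phi_ID_def
    by (intro conjI exI[of _ "\<lambda>k. real (n k)"]
        exI[of _ "\<lambda>k t. g (t / a k) * exp (- (\<i> * complex_of_real (t * b k)))"]) auto
next
  assume "phi_ID \<phi> f"
  then obtain a F where aF: "\<And>n::nat. 1 \<le> n \<Longrightarrow> 0 < a n" "\<And>n::nat. 1 \<le> n \<Longrightarrow> is_char_fun (F n)"
    and lim: "\<And>t. (\<lambda>n. \<phi> (complex_of_real (a n) * (1 - F n t))) \<longlonglongrightarrow> f t"
    unfolding phi_ID_def by blast
  \<comment> \<open>Indices are shifted by one because \<open>phi_ID\<close> constrains
    \<open>a\<close> and \<open>F\<close> only from index 1 on.\<close>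
  obtain g and n :: "nat \<Rightarrow> nat" and c :: "nat \<Rightarrow> real" where
    g: "is_char_fun g" and n: "strict_mono n" "\<forall>k. 0 < n k" and c: "\<forall>k. 0 < c k"
    and near: "\<And>t. (\<lambda>k. of_nat (n k) * (1 - g (t / c k)) -
      complex_of_real (a (Suc k)) * (1 - F (Suc k) t)) \<longlonglongrightarrow> 0"
    using universal_char_fun[of "\<lambda>k. a (Suc k)" "\<lambda>k. F (Suc k)"] aF by auto
  have "(\<lambda>k. \<phi> (of_nat (n k) * (1 - g (t / c k)))) \<longlonglongrightarrow> f t" for t
  proof -
    let ?z = "\<lambda>k. of_nat (n k) * (1 - g (t / c k))"
    let ?w = "\<lambda>k. complex_of_real (a (Suc k)) * (1 - F (Suc k) t)"
    \<comment> \<open>\<open>\<phi>\<close> is known to be the transform only where the real part is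
      nonnegative.\<close>
    have "0 \<le> Re (?z k)" for k
      using is_char_fun_Re_one_minus[OF g, of "t / c k"] by simp
    moreover have "0 \<le> Re (?w k)" for k
      using is_char_fun_Re_one_minus[OF aF(2)[of "Suc k"], of t] aF(1)[of "Suc k"] by simp
    ultimately have "(\<lambda>k. \<phi> (?z k) - \<phi> (?w k)) \<longlonglongrightarrow> 0"
      using laplace_transform_uniformly_continuous[OF assms(1) _ _ near[of t]]
      by (simp add: assms(2))
    from tendsto_add[OF this LIMSEQ_Suc[OF lim[of t]]] show ?thesis
      by simp
  qed
  then have "g \<in> partial_attraction_domain \<phi> f"
    unfolding partial_attraction_domain_def using g n c
    by (intro CollectI conjI exI[of _ n] exI[of _ c] exI[of _ "\<lambda>_. 0"]) auto
  then show "partial_attraction_domain \<phi> f \<noteq> {}"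
    by blast
qed

end
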